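(* Let $k\ge 0$ be an integer, let $\varepsilon(x,\xi)\ge 0$ and $\rho(x,\xi)$ belong to $C^{k+1}(\mathbb{S}D)$, let $f(t,x,\xi)\in C^{k+1}(\mathbb{R}\times\mathbb{S}D)$, and put $\alpha=\varepsilon+\mathrm{i}\rho$. Let $u_k(t,x,\xi)$ be the non-stationary attenuated ray transform of order $k$ of $f$. Then $u_k$ is a solution of the equation $$(\mathcal{L}^t_{k+1}u_k)(t,x,\xi)=f(t,x,\xi),\qquad t\in\mathbb{R},\ (x,\xi)\in\mathbb{S}D .$$ In particular, if $f(t,x,\xi)=\langle w(t,x),\xi^m\rangle$, where $w(t,x)$ is a symmetric $m$-tensor field, then $$(\mathcal{L}^t_{k+1}u_k)(t,x,\xi)=\langle w(t,x),\xi^m\rangle ,\qquad t\in\mathbb{R},\ (x,\xi)\in\mathbb{S}D .$$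
   Context: $D\subset\mathbb{R}^3$ is a bounded convex domain with smooth boundary, $\mathbb{S}^2$ is the unit sphere of $\mathbb{R}^3$, and $\mathbb{S}D=\{(x,\xi): x\in D,\ \xi\in\mathbb{S}^2\}$. The functions $\varepsilon,\rho$ are real-valued. The functions $\varepsilon,\rho,f$ (and the field $w$) are bounded and finite with respect to $x$, i.e. they vanish for $x$ outside some compact subset of $D$; they are extended by zero to all $x\in\mathbb{R}^3$. The non-stationary attenuated ray transform (ART) of order $k$ of $f$ is $$u_k(t,x,\xi)=\int_0^\infty s^k\exp\Big(-\int_0^s\alpha(x-\sigma\xi,\xi)\,d\sigma\Big) f(t-s,x-s\xi,\xi)\,ds .$$ The operator $\mathcal{H}$ is $(\mathcal{H}\psi)(t,x,\xi)=\frac{d}{d\tau}\psi(t,x+\tau\xi,\xi)\big|_{\tau=0}=\sum_{j=1}^3\xi^j\frac{\partial\psi}{\partial x^j}(t,x,\xi)$. The operators $\mathcal{L}^t_k$ are defined by $\mathcal{L}^t_1\psi=\big(\frac{\partial}{\partial t}+\mathcal{H}+\alpha\big)\psi$ and $\mathcal{L}^t_k\psi=\frac{1}{k-1}\big(\frac{\partial}{\partial t}+\mathcal{H}+\alpha\big)\mathcal{L}^t_{k-1}\psi$ for integers $k>1$, where $\alpha$ acts by multiplication; thus $\mathcal{L}^t_{k+1}=\frac1{k!}\big(\frac{\partial}{\partial t}+\mathcal{H}+\alpha\big)^{k+1}$. A symmetric $m$-tensor field $w$ ($m\ge0$ an integer) has components $w_{i_1\ldots i_m}(t,x)$, $i_1,\dots,i_m\in\{1,2,3\}$,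 symmetric in the indices, and $\langle w(t,x),\xi^m\rangle=\sum_{i_1,\dots,i_m=1}^3 w_{i_1\ldots i_m}(t,x)\xi^{i_1}\cdots\xi^{i_m}$. *)

theory Defs
  imports "HOL-Analysis.Analysis"
begin

section \<open>Functions of class $C^n$\<close>

text \<open>Class \<open>C\<^sup>n\<close>, intended for open \<open>U\<close>; all derivatives are two-sided derivatives in the ambient space.\<close>

primrec Ck_on :: "nat \<Rightarrow> 'a::euclidean_space set \<Rightarrow> ('a \<Rightarrow> 'b::real_normed_vector) \<Rightarrow> bool" where
  "Ck_on 0 U g \<longleftrightarrow> continuous_on U g"
| "Ck_on (Suc n) U g \<longleftrightarrow>
     (\<forall>x\<in>U. g differentiable (at x)) \<and>
     (\<forall>v. Ck_on n U (\<lambda>x. frechet_derivative g (at x) v))"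

text \<open>Class \<open>C\<^sup>n\<close> on an embedded submanifold \<open>M\<close> of Euclidean space, such as \<open>D \<times> S\<^sup>2\<close>:
  near each point of \<open>M\<close> the function is the restriction of a \<open>C\<^sup>n\<close> function on an open subset of
  the ambient space. For embedded submanifolds this is the same class as the one given by charts.\<close>

definition Ck_on_submanifold ::
  "nat \<Rightarrow> 'a::euclidean_space set \<Rightarrow> ('a \<Rightarrow> 'b::real_normed_vector) \<Rightarrow> bool" where
  "Ck_on_submanifold n M g \<longleftrightarrow>
     (\<forall>p\<in>M. \<exists>U G. open U \<and> p \<in> U \<and> Ck_on n U G \<and> (\<forall>q\<in>U \<inter> M. G q = g q))"

section \<open>Domains and data\<close>

definition smooth_boundary :: "'a::euclidean_space set \<Rightarrow> bool" where
  "smooth_boundary D \<longleftrightarrow>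
     (\<forall>p\<in>frontier D. \<exists>U (\<phi> :: 'a \<Rightarrow> real).
        open U \<and> p \<in> U \<and> (\<forall>n. Ck_on n U \<phi>) \<and>
        (\<forall>x\<in>U. frechet_derivative \<phi> (at x) \<noteq> (\<lambda>_. 0)) \<and>
        D \<inter> U = {x \<in> U. \<phi> x < 0})"

definition smooth_bounded_convex_domain :: "'a::euclidean_space set \<Rightarrow> bool" where
  "smooth_bounded_convex_domain D \<longleftrightarrow>
     open D \<and> D \<noteq> {} \<and> bounded D \<and> convex D \<and> smooth_boundary D"

abbreviation S2 :: "(real^3) set" where
  "S2 \<equiv> sphere 0 1"

text \<open>Boundedness and finiteness with respect to \<open>x\<close>, for a function of \<open>x\<close> and of further
  arguments \<open>p \<in> P\<close>. The compact set does not depend on \<open>p\<close>. The function lives on all of space and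
  is required to be zero off the compact set, so it already is the extension by zero.\<close>

definition bounded_finite ::
  "'p set \<Rightarrow> 'a::euclidean_space set \<Rightarrow> ('p \<Rightarrow> 'a \<Rightarrow> 'b::real_normed_vector) \<Rightarrow> bool" where
  "bounded_finite P D g \<longleftrightarrow>
     bounded ((\<lambda>(p, x). g p x) ` (P \<times> D)) \<and>
     (\<exists>K. compact K \<and> K \<subseteq> D \<and> (\<forall>p\<in>P. \<forall>x. x \<notin> K \<longrightarrow> g p x = 0))"

section \<open>Symmetric tensor fields\<close>

text \<open>The component with indices \<open>i\<^sub>1, \<dots>, i\<^sub>m\<close> of an \<open>m\<close>-tensor field \<open>w\<close> is \<open>w t x [i\<^sub>1, \<dots>, i\<^sub>m]\<close>;
  values at lists of other lengths are irrelevant.\<close>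

type_synonym tensor_field = "real \<Rightarrow> real^3 \<Rightarrow> 3 list \<Rightarrow> complex"

definition symmetric_tensor_field :: "nat \<Rightarrow> tensor_field \<Rightarrow> bool" where
  "symmetric_tensor_field m w \<longleftrightarrow>
     (\<forall>t x I J. length I = m \<longrightarrow> mset J = mset I \<longrightarrow> w t x J = w t x I)"

definition tensor_power_pairing ::
  "nat \<Rightarrow> tensor_field \<Rightarrow> real \<Rightarrow> real^3 \<Rightarrow> real^3 \<Rightarrow> complex" where
  "tensor_power_pairing m w t x \<xi> =
     (\<Sum>I | length I = m. w t x I * complex_of_real (prod_list (map (\<lambda>i. \<xi> $ i) I)))"

section \<open>The attenuated ray transform and the transport operators\<close>

definition ART ::
  "nat \<Rightarrow> (real^3 \<Rightarrow> real^3 \<Rightarrow> complex) \<Rightarrow> (real \<Rightarrow> real^3 \<Rightarrow> real^3 \<Rightarrow> complex)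
     \<Rightarrow> real \<Rightarrow> real^3 \<Rightarrow> real^3 \<Rightarrow> complex" where
  "ART k \<alpha> f t x \<xi> =
     integral {0..} (\<lambda>s. complex_of_real (s ^ k)
       * exp (- integral {0..s} (\<lambda>\<sigma>. \<alpha> (x - \<sigma> *\<^sub>R \<xi>) \<xi>))
       * f (t - s) (x - s *\<^sub>R \<xi>) \<xi>)"

definition H_op ::
  "(real \<Rightarrow> real^3 \<Rightarrow> real^3 \<Rightarrow> complex) \<Rightarrow> real \<Rightarrow> real^3 \<Rightarrow> real^3 \<Rightarrow> complex" where
  "H_op \<psi> t x \<xi> = vector_derivative (\<lambda>\<tau>. \<psi> t (x + \<tau> *\<^sub>R \<xi>) \<xi>) (at 0)"

lemma H_op_eq_sum_partial_derivatives:
  assumes "(\<lambda>y. \<psi> t y \<xi>) differentiable (at x)"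
  shows "H_op \<psi> t x \<xi> =
    (\<Sum>j\<in>UNIV. complex_of_real (\<xi> $ j) * frechet_derivative (\<lambda>y. \<psi> t y \<xi>) (at x) (axis j 1))"
proof -
  let ?g = "\<lambda>y. \<psi> t y \<xi>"
  let ?F = "frechet_derivative ?g (at x)"
  have F: "(?g has_derivative ?F) (at x)"
    using assms by (simp add: frechet_derivative_works)
  have lin: "linear ?F"
    using F by (rule has_derivative_linear)
  have line: "((\<lambda>\<tau>. x + \<tau> *\<^sub>R \<xi>) has_derivative (\<lambda>h. h *\<^sub>R \<xi>)) (at 0)"
    by (auto intro!: derivative_eq_intros)
  have "((\<lambda>\<tau>. ?g (x + \<tau> *\<^sub>R \<xi>)) has_derivative (\<lambda>h. ?F (h *\<^sub>R \<xi>))) (at 0)"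
    using has_derivative_compose[OF line, of ?g ?F] F by simp
  then have "((\<lambda>\<tau>. ?g (x + \<tau> *\<^sub>R \<xi>)) has_vector_derivative ?F \<xi>) (at 0)"
    unfolding has_vector_derivative_def by (simp add: linear_cmul[OF lin])
  then have "H_op \<psi> t x \<xi> = ?F \<xi>"
    unfolding H_op_def by (rule vector_derivative_at)
  also have "\<dots> = ?F (\<Sum>j\<in>UNIV. (\<xi> $ j) *\<^sub>R axis j 1)"
    using basis_expansion[of \<xi>] by (simp add: scalar_mult_eq_scaleR)
  also have "\<dots> = (\<Sum>j\<in>UNIV. complex_of_real (\<xi> $ j) * ?F (axis j 1))"
    by (simp only: linear_sum[OF lin] linear_cmul[OF lin] scaleR_conv_of_real[where 'a = complex])
  finally show ?thesis .
qed

definition transport_op ::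
  "(real^3 \<Rightarrow> real^3 \<Rightarrow> complex) \<Rightarrow> (real \<Rightarrow> real^3 \<Rightarrow> real^3 \<Rightarrow> complex)
     \<Rightarrow> real \<Rightarrow> real^3 \<Rightarrow> real^3 \<Rightarrow> complex" where
  "transport_op \<alpha> \<psi> t x \<xi> =
     vector_derivative (\<lambda>t'. \<psi> t' x \<xi>) (at t) + H_op \<psi> t x \<xi> + \<alpha> x \<xi> * \<psi> t x \<xi>"

text \<open>\<open>L_op \<alpha> n\<close> is \<open>L\<^sup>t\<^sub>n\<close> for \<open>n \<ge> 1\<close>; at \<open>n = 0\<close> it is the identity by convention.
  The third equation is the recursion at index \<open>n + 2\<close>, with factor \<open>1 / (n + 1)\<close>.\<close>

fun L_op ::
  "(real^3 \<Rightarrow> real^3 \<Rightarrow> complex) \<Rightarrow> nat \<Rightarrow> (real \<Rightarrow> real^3 \<Rightarrow> real^3 \<Rightarrow> complex)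
     \<Rightarrow> real \<Rightarrow> real^3 \<Rightarrow> real^3 \<Rightarrow> complex" where
  "L_op \<alpha> 0 \<psi> = \<psi>"
| "L_op \<alpha> (Suc 0) \<psi> = transport_op \<alpha> \<psi>"
| "L_op \<alpha> (Suc (Suc n)) \<psi> =
     (\<lambda>t x \<xi>. 1 / of_nat (Suc n) * transport_op \<alpha> (L_op \<alpha> (Suc n) \<psi>) t x \<xi>)"

text \<open>Classical solutions of \<open>L\<^sup>t\<^sub>n u = f\<close> on \<open>\<real> \<times> D \<times> S\<^sup>2\<close>. As \<open>vector_derivative\<close> is a total
  operator, the existence of every derivative occurring in \<open>L\<^sup>t\<^sub>n u\<close> is stated explicitly;
  differentiability in \<open>x\<close> makes both expressions for \<open>H_op\<close> meaningful.\<close>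

definition classical_solution ::
  "(real^3) set \<Rightarrow> (real^3 \<Rightarrow> real^3 \<Rightarrow> complex) \<Rightarrow> nat
     \<Rightarrow> (real \<Rightarrow> real^3 \<Rightarrow> real^3 \<Rightarrow> complex) \<Rightarrow> (real \<Rightarrow> real^3 \<Rightarrow> real^3 \<Rightarrow> complex) \<Rightarrow> bool" where
  "classical_solution D \<alpha> n u f \<longleftrightarrow>
     (\<forall>t. \<forall>x\<in>D. \<forall>\<xi>\<in>S2.
        (\<forall>j<n. (\<lambda>t'. L_op \<alpha> j u t' x \<xi>) differentiable (at t) \<and>
               (\<lambda>y. L_op \<alpha> j u t y \<xi>) differentiable (at x)) \<and>
        L_op \<alpha> n u t x \<xi> = f t x \<xi>)"

end

theory Submission
  imports Defs
begin

text \<open>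
  Fix a direction \<open>\<xi>\<close> and read a function of \<open>(t, x)\<close> as a function of one point \<open>z\<close> of space-time,
  so that \<open>\<partial>\<^sub>t + H\<close> becomes the derivative along the single vector \<open>e = (1, \<xi>)\<close> and, with
  \<open>A(z, s) = \<integral>\<^sub>0\<^sup>s a(z - \<sigma>e) d\<sigma>\<close>, the transform is
  \<open>u\<^sub>k(z) = \<integral>\<^sub>0\<^sup>\<infinity> s\<^sup>k exp(-A(z, s)) F(z - se) ds\<close>.

  Move \<open>z\<close> and \<open>s\<close> together, along \<open>(e, 1)\<close>. The source point \<open>z - se\<close> does not move, and the
  optical depth \<open>A\<close> grows at rate \<open>a(z)\<close>, because only the near end of the segment of
  integration advances (\<open>absorption_flow_derivative\<close>). Hence the integrand \<open>h\<^sub>k\<close> satisfies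
  \<open>Dh\<^sub>k(e, 1) = k h\<^sub>k\<^sub>-\<^sub>1 - a h\<^sub>k\<close> (\<open>ray_integrand_flow_derivative\<close>), that is,
  \<open>(D\<^sub>e + a) h\<^sub>k = k h\<^sub>k\<^sub>-\<^sub>1 - \<partial>\<^sub>s h\<^sub>k\<close>. Integration over \<open>s\<close> turns this into
  \<open>(\<partial>\<^sub>t + H + \<alpha>) u\<^sub>k = k u\<^sub>k\<^sub>-\<^sub>1\<close> for \<open>k \<ge> 1\<close>; for \<open>k = 0\<close> the boundary term at \<open>s = 0\<close>
  survives and the right-hand side is \<open>f\<close> (\<open>ray_transform_transport_equation\<close>,
  \<open>transport_op_ART\<close>).

  Each transport operator therefore lowers the order by one, and iteration of this recursion
  reaches \<open>f\<close> after \<open>k + 1\<close> steps, with factor 1 thanks to the normalisation of the operators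
  (\<open>L_op_hierarchy\<close>). Every intermediate function is a multiple of a transform of \<open>f\<close> of lower
  order, so at each stage what has to be differentiated, once, is such a transform. The section on \<open>C\<^sup>1\<close>
  functions supplies this: the closure properties of the class, including differentiation under
  the integral.
\<close>

section \<open>Functions of class $C^1$\<close>

text \<open>The separate name keeps the class from being unfolded into its derivative conditions during
  simplification.\<close>

definition C1_on :: "'a::euclidean_space set \<Rightarrow> ('a \<Rightarrow> 'b::real_normed_vector) \<Rightarrow> bool" where
  "C1_on = Ck_on (Suc 0)"

text \<open>Continuity of the derivative may be tested on each direction separately; the rules that follow
  trade this for continuity in operator norm, which finite dimension allows. The
  directional form suits products and pairs, the operator form compositions and integrals.\<close>

lemma C1_onI:
  assumes "\<And>x. x \<in> S \<Longrightarrow> (g has_derivative g' x) (at x)"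
    and "\<And>v. continuous_on S (\<lambda>x. g' x v)"
  shows "C1_on S g"
proof -
  have "frechet_derivative g (at x) = g' x" if "x \<in> S" for x
    using frechet_derivative_at[OF assms(1)[OF that]] by simp
  then have "continuous_on S (\<lambda>x. frechet_derivative g (at x) v)" for v
    using assms(2)[of v] by (simp cong: continuous_on_cong)
  moreover have "\<forall>x\<in>S. g differentiable at x"
    using assms(1) differentiable_def by blast
  ultimately show ?thesis
    by (simp add: C1_on_def)
qed

lemma C1_on_blinfunI:
  fixes g' :: "'a::euclidean_space \<Rightarrow> 'a \<Rightarrow>\<^sub>L 'b::real_normed_vector"
  assumes "\<And>x. x \<in> S \<Longrightarrow> (g has_derivative blinfun_apply (g' x)) (at x)"
    and "continuous_on S g'"
  shows "C1_on S g"
  by (rule C1_onI[OF assms(1)]) (auto intro!: continuous_intros assms(2))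

lemma C1_onE:
  fixes g :: "'a::euclidean_space \<Rightarrow> 'b::real_normed_vector"
  assumes "C1_on S g"
  obtains g' :: "'a \<Rightarrow> 'a \<Rightarrow>\<^sub>L 'b"
  where "\<And>x. x \<in> S \<Longrightarrow> (g has_derivative blinfun_apply (g' x)) (at x)"
    and "continuous_on S g'"
proof
  let ?g' = "\<lambda>x. Blinfun (frechet_derivative g (at x))"
  have D: "(g has_derivative frechet_derivative g (at x)) (at x)" if "x \<in> S" for x
    using assms that by (simp add: C1_on_def frechet_derivative_works)
  then have eq: "blinfun_apply (?g' x) = frechet_derivative g (at x)" if "x \<in> S" for x
    using that by (blast intro: bounded_linear_Blinfun_apply has_derivative_bounded_linear)
  show "(g has_derivative blinfun_apply (?g' x)) (at x)" if "x \<in> S" for x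
    using D eq that by simp
  have "continuous_on S (\<lambda>x. ?g' x i)" for i
    using assms by (simp add: C1_on_def eq cong: continuous_on_cong)
  then show "continuous_on S ?g'"
    by (intro continuous_on_blinfun_componentwise)
qed

lemma C1_on_continuous_on:
  assumes "C1_on S g"
  shows "continuous_on S g"
  using assms unfolding C1_on_def
  by (auto intro!: continuous_at_imp_continuous_on differentiable_imp_continuous_within)

lemma Ck_on_Suc_imp_C1_on:
  assumes "Ck_on (Suc n) S g"
  shows "C1_on S g"
proof -
  have "continuous_on S h" if "Ck_on n S h" for h :: "'a \<Rightarrow> 'b"
    using that by (cases n)
      (auto intro!: continuous_at_imp_continuous_on differentiable_imp_continuous_within)
  then show ?thesis
    using assms by (simp add: C1_on_def)
qed

lemma C1_on_subset: "C1_on T g \<Longrightarrow> S \<subseteq> T \<Longrightarrow> C1_on S g"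
  by (auto simp: C1_on_def intro: continuous_on_subset)

lemma C1_on_cong_open:
  assumes "C1_on S g" and "open S" and "\<And>x. x \<in> S \<Longrightarrow> g x = h x"
  shows "C1_on S h"
proof -
  obtain g' where g': "\<And>x. x \<in> S \<Longrightarrow> (g has_derivative blinfun_apply (g' x)) (at x)"
    "continuous_on S g'"
    using C1_onE[OF assms(1)] by metis
  have "(h has_derivative blinfun_apply (g' x)) (at x)" if "x \<in> S" for x
    using g'(1)[OF that] assms(2) that assms(3) by (rule has_derivative_transform_within_open)
  then show ?thesis
    using g'(2) by (rule C1_on_blinfunI)
qed

lemma C1_on_locally:
  assumes "\<And>x. x \<in> S \<Longrightarrow> \<exists>U. open U \<and> x \<in> U \<and> C1_on U g"
  shows "C1_on S g"
proof -
  have "g differentiable at x \<and>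
      continuous (at x within S) (\<lambda>x. frechet_derivative g (at x) v)" if x: "x \<in> S" for x v
  proof -
    obtain U where U: "open U" "x \<in> U" "C1_on U g"
      using assms[OF x] by blast
    then have "continuous (at x) (\<lambda>x. frechet_derivative g (at x) v)"
      by (simp add: C1_on_def continuous_on_eq_continuous_at)
    with U show ?thesis
      by (simp add: C1_on_def continuous_at_imp_continuous_at_within)
  qed
  then show ?thesis
    by (simp add: C1_on_def continuous_on_eq_continuous_within)
qed

lemma C1_on_compose:
  assumes "C1_on T g" and "C1_on S h" and "h ` S \<subseteq> T"
  shows "C1_on S (\<lambda>x. g (h x))"
proof -
  obtain g' where g': "\<And>x. x \<in> T \<Longrightarrow> (g has_derivative blinfun_apply (g' x)) (at x)"
    and cg': "continuous_on T g'"
    using C1_onE[OF assms(1)] by metis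
  obtain h' where h': "\<And>x. x \<in> S \<Longrightarrow> (h has_derivative blinfun_apply (h' x)) (at x)"
    and ch': "continuous_on S h'"
    using C1_onE[OF assms(2)] by metis
  show ?thesis
  proof (rule C1_on_blinfunI)
    fix x assume "x \<in> S"
    then have "((\<lambda>x. g (h x)) has_derivative (\<lambda>v. g' (h x) (h' x v))) (at x)"
      using assms(3) by (intro has_derivative_compose[OF h' g']) auto
    then show "((\<lambda>x. g (h x)) has_derivative blinfun_apply (g' (h x) o\<^sub>L h' x)) (at x)"
      by (simp add: blinfun_compose.rep_eq o_def)
  next
    have "continuous_on S (\<lambda>x. g' (h x))"
      using cg' C1_on_continuous_on[OF assms(2)] assms(3) by (rule continuous_on_compose2)
    then show "continuous_on S (\<lambda>x. g' (h x) o\<^sub>L h' x)"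
      by (intro continuous_intros ch')
  qed
qed

lemma C1_on_Pair:
  assumes "C1_on S g" and "C1_on S h"
  shows "C1_on S (\<lambda>x. (g x, h x))"
proof -
  obtain g' where g': "\<And>x. x \<in> S \<Longrightarrow> (g has_derivative blinfun_apply (g' x)) (at x)"
    and cg': "continuous_on S g'"
    using C1_onE[OF assms(1)] by metis
  obtain h' where h': "\<And>x. x \<in> S \<Longrightarrow> (h has_derivative blinfun_apply (h' x)) (at x)"
    and ch': "continuous_on S h'"
    using C1_onE[OF assms(2)] by metis
  show ?thesis
    by (rule C1_onI[of S _ "\<lambda>x v. (g' x v, h' x v)"])
      (auto intro!: derivative_eq_intros g' h' continuous_intros cg' ch')
qed

lemma C1_on_const: "C1_on S (\<lambda>_. c)"
  by (rule C1_onI[of S _ "\<lambda>_ _. 0"]) (auto intro!: derivative_eq_intros)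

lemma C1_on_bounded_linear:
  assumes "bounded_linear f"
  shows "C1_on S f"
  by (rule C1_onI[of S _ "\<lambda>_. f"]) (auto intro: bounded_linear_imp_has_derivative assms)

lemma C1_on_add:
  assumes "C1_on S g" and "C1_on S h"
  shows "C1_on S (\<lambda>x. g x + h x)"
proof -
  obtain g' where g': "\<And>x. x \<in> S \<Longrightarrow> (g has_derivative blinfun_apply (g' x)) (at x)"
    and cg': "continuous_on S g'"
    using C1_onE[OF assms(1)] by metis
  obtain h' where h': "\<And>x. x \<in> S \<Longrightarrow> (h has_derivative blinfun_apply (h' x)) (at x)"
    and ch': "continuous_on S h'"
    using C1_onE[OF assms(2)] by metis
  show ?thesis
    by (rule C1_on_blinfunI[of S _ "\<lambda>x. g' x + h' x"])
      (auto intro!: derivative_eq_intros g' h' continuous_intros cg' ch' simp: blinfun.add_left)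
qed

lemma C1_on_bilinear:
  assumes "bounded_bilinear pr" and "C1_on S g" and "C1_on S h"
  shows "C1_on S (\<lambda>x. pr (g x) (h x))"
proof -
  interpret bounded_bilinear pr by fact
  obtain g' where g': "\<And>x. x \<in> S \<Longrightarrow> (g has_derivative blinfun_apply (g' x)) (at x)"
    and cg': "continuous_on S g'"
    using C1_onE[OF assms(2)] by metis
  obtain h' where h': "\<And>x. x \<in> S \<Longrightarrow> (h has_derivative blinfun_apply (h' x)) (at x)"
    and ch': "continuous_on S h'"
    using C1_onE[OF assms(3)] by metis
  note c = C1_on_continuous_on[OF assms(2)] C1_on_continuous_on[OF assms(3)]
  show ?thesis
    by (rule C1_onI[of S _ "\<lambda>x v. pr (g x) (h' x v) + pr (g' x v) (h x)"])
      (auto intro!: FDERIV g' h' continuous_intros continuous_on cg' ch' c)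
qed

lemmas C1_on_mult = C1_on_bilinear[OF bounded_bilinear_mult]
lemmas C1_on_scaleR = C1_on_bilinear[OF bounded_bilinear_scaleR]

lemma C1_on_exp: "C1_on S (exp :: complex \<Rightarrow> complex)"
proof (rule C1_onI)
  show "(exp has_derivative (\<lambda>v. exp w * v)) (at w)" for w :: complex
    using DERIV_exp[of w] by (simp add: has_field_derivative_def)
qed (intro continuous_intros)

text \<open>The Leibniz rule, with the partial derivative in the parameter written as the joint derivative
  in the direction \<open>(v, 0)\<close>. The joint derivative is what the method of moving \<open>z\<close> and \<open>s\<close>
  together needs.\<close>

lemma
  fixes g :: "'a::euclidean_space \<times> real \<Rightarrow> 'b::euclidean_space"
  assumes C1: "C1_on UNIV g" and g': "\<And>p. (g has_derivative g' p) (at p)"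
  shows has_derivative_integral_parameter:
      "((\<lambda>z. integral {a..b} (\<lambda>s. g (z, s))) has_derivative
        (\<lambda>v. integral {a..b} (\<lambda>s. g' (z, s) (v, 0)))) (at z)"
    and C1_on_integral_parameter: "C1_on UNIV (\<lambda>z. integral {a..b} (\<lambda>s. g (z, s)))"
proof -
  obtain G where G: "\<And>p. (g has_derivative blinfun_apply (G p)) (at p)"
    and cG: "continuous_on UNIV G"
    using C1_onE[OF C1] by (metis UNIV_I)
  have g'_eq: "g' p = blinfun_apply (G p)" for p
    using has_derivative_unique[OF g' G] .
  define inl :: "'a \<Rightarrow>\<^sub>L ('a \<times> real)" where "inl = Blinfun (\<lambda>v. (v, 0))"
  have inl: "blinfun_apply inl v = (v, 0)" for v
    unfolding inl_def by (subst bounded_linear_Blinfun_apply) (auto intro!: bounded_linear_intros)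
  define P where "P z s = G (z, s) o\<^sub>L inl" for z s
  have cP: "continuous_on (UNIV \<times> cbox a b) (\<lambda>(z, s). P z s)"
    unfolding P_def case_prod_beta
    by (intro continuous_intros continuous_on_compose2[OF cG]) auto
  have cP1: "continuous_on (cbox a b) (P z)" for z
    unfolding P_def by (intro continuous_intros continuous_on_compose2[OF cG]) auto
  have D: "((\<lambda>z. integral (cbox a b) (\<lambda>s. g (z, s))) has_derivative
      blinfun_apply (integral (cbox a b) (P z))) (at z within UNIV)" for z
  proof (rule leibniz_rule[OF _ _ cP])
    fix z :: 'a and s :: real
    have "((\<lambda>z. (z, s)) has_derivative (\<lambda>v. (v, 0))) (at z)"
      by (auto intro!: derivative_eq_intros)
    from has_derivative_compose[OF this G]
    show "((\<lambda>z. g (z, s)) has_derivative blinfun_apply (P z s)) (at z within UNIV)"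
      by (simp add: P_def o_def inl blinfun_compose.rep_eq)
    show "(\<lambda>s. g (z, s)) integrable_on cbox a b"
      by (intro integrable_continuous continuous_on_compose2[OF C1_on_continuous_on[OF C1]]
          continuous_intros) auto
  qed auto
  have eq: "blinfun_apply (integral (cbox a b) (P z))
      = (\<lambda>v. integral {a..b} (\<lambda>s. g' (z, s) (v, 0)))" for z
    using blinfun_apply_integral[OF integrable_continuous[OF cP1]]
    by (simp add: fun_eq_iff P_def inl g'_eq)
  show "((\<lambda>z. integral {a..b} (\<lambda>s. g (z, s))) has_derivative
        (\<lambda>v. integral {a..b} (\<lambda>s. g' (z, s) (v, 0)))) (at z)"
    using D[of z] unfolding eq by simp
  show "C1_on UNIV (\<lambda>z. integral {a..b} (\<lambda>s. g (z, s)))"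
    using D integral_continuous_on_param[OF cP]
    by (intro C1_on_blinfunI[where g' = "\<lambda>z. integral (cbox a b) (P z)"]) auto
qed

text \<open>A function on a submanifold is only locally the restriction of an ambient \<open>C\<^sup>1\<close> function.
  Such extensions are not unique and need not fit together, but after composition with a map into
  the submanifold they all give the same function.\<close>

lemma C1_on_pullback_submanifold:
  assumes g: "Ck_on_submanifold (Suc n) M g" and h: "C1_on W h" and W: "open W" "h ` W \<subseteq> M"
  shows "C1_on W (\<lambda>q. g (h q))"
proof (rule C1_on_locally)
  fix q assume q: "q \<in> W"
  then obtain U G where U: "open U" "h q \<in> U" and G: "Ck_on (Suc n) U G"
    and Gg: "\<forall>p\<in>U \<inter> M. G p = g p"
    using g W(2) unfolding Ck_on_submanifold_def by blast
  define V where "V = W \<inter> h -` U"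
  have V: "open V"
    unfolding V_def by (rule continuous_open_preimage[OF C1_on_continuous_on[OF h] W(1) U(1)])
  have "C1_on V (\<lambda>q. G (h q))"
    by (rule C1_on_compose[OF Ck_on_Suc_imp_C1_on[OF G] C1_on_subset[OF h]]) (auto simp: V_def)
  then have "C1_on V (\<lambda>q. g (h q))"
    using V by (rule C1_on_cong_open) (use W Gg in \<open>auto simp: V_def\<close>)
  moreover have "q \<in> V"
    using q U(2) by (simp add: V_def)
  ultimately show "\<exists>U. open U \<and> q \<in> U \<and> C1_on U (\<lambda>q. g (h q))"
    using V by blast
qed

lemma C1_on_extend_by_zero:
  assumes "C1_on S g" and "open S" and "closed K" and "K \<subseteq> S" and "\<And>x. x \<notin> K \<Longrightarrow> g x = 0"
  shows "C1_on UNIV g"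
proof (rule C1_on_locally)
  fix x
  have "C1_on (- K) g"
    by (rule C1_on_cong_open[OF C1_on_const[of _ 0]]) (simp_all add: assms(3,5) open_Compl)
  moreover have "open (- K)"
    using assms(3) by (rule open_Compl)
  ultimately show "\<exists>U. open U \<and> x \<in> U \<and> C1_on U g"
    using assms(1,2,4) by (metis Compl_iff subsetD)
qed

section \<open>Optical depth along a ray\<close>

text \<open>The optical depth \<open>\<integral>\<^sub>0\<^sup>s a(z - \<sigma>e) d\<sigma>\<close>, rescaled to the unit interval. The fixed limits
  make the Leibniz rule applicable jointly in \<open>z\<close> and \<open>s\<close>, and they extend the function to
  \<open>s < 0\<close> in such a way that it is differentiable at \<open>s = 0\<close> from both sides.\<close>

definition absorption :: "'a::euclidean_space \<Rightarrow> ('a \<Rightarrow> complex) \<Rightarrow> 'a \<times> real \<Rightarrow> complex" where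
  "absorption e a p = snd p *\<^sub>R integral {0..1} (\<lambda>\<theta>. a (fst p - (snd p * \<theta>) *\<^sub>R e))"

lemma absorption_eq_integral:
  assumes "0 \<le> s"
  shows "absorption e a (z, s) = integral {0..s} (\<lambda>\<sigma>. a (z - \<sigma> *\<^sub>R e))"
proof (cases "s = 0")
  case False
  with assms have s: "0 < s" by simp
  have "(\<lambda>x. x / s) ` {0..s} = {0..1}"
    using s by (auto simp: image_iff field_simps intro!: bexI[of _ "_ * s"])
  then have "integral {0..1} (\<lambda>\<theta>. a (z - (s * \<theta>) *\<^sub>R e))
      = (1 / s) *\<^sub>R integral {0..s} (\<lambda>\<sigma>. a (z - \<sigma> *\<^sub>R e))"
    using integral_stretch_real[of s 0 s "\<lambda>\<sigma>. a (z - \<sigma> *\<^sub>R e)"] s by simp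
  then show ?thesis
    using s by (simp add: absorption_def)
qed (simp add: absorption_def)

lemma C1_backward_ray: "C1_on S (\<lambda>p. fst p - snd p *\<^sub>R e)"
  for e :: "'a::euclidean_space"
proof -
  have "C1_on S (\<lambda>p. fst p + snd p *\<^sub>R (- e))"
    by (intro C1_on_add C1_on_scaleR C1_on_const C1_on_bounded_linear bounded_linear_fst
        bounded_linear_snd)
  then show ?thesis by simp
qed

text \<open>In the direction \<open>(e, 1)\<close> the far end \<open>z - se\<close> of the segment stays fixed while its near end
  \<open>z\<close> advances by \<open>e\<close>, so the optical depth changes at rate \<open>a z\<close>. On the rescaled integral this is
  the fundamental theorem of calculus for \<open>(1 - \<theta>) a(z - s\<theta>e)\<close>.\<close>

lemma
  fixes a :: "'a::euclidean_space \<Rightarrow> complex"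
  assumes a: "C1_on UNIV a"
  shows C1_absorption: "C1_on UNIV (absorption e a)"
    and absorption_flow_derivative:
      "(absorption e a has_derivative A') (at (z, s)) \<Longrightarrow> A' (e, 1) = a z"
proof -
  obtain a' where a': "\<And>x. (a has_derivative blinfun_apply (a' x)) (at x)"
    and ca': "continuous_on UNIV a'"
    using C1_onE[OF a] by (metis UNIV_I)
  have ca: "continuous_on UNIV a"
    by (rule C1_on_continuous_on[OF a])
  define b where "b = (\<lambda>q::('a \<times> real) \<times> real. a (fst (fst q) - (snd (fst q) * snd q) *\<^sub>R e))"
  have "C1_on UNIV (\<lambda>q::('a \<times> real) \<times> real. (fst (fst q), snd (fst q) * snd q))"
    by (intro C1_on_Pair C1_on_mult C1_on_bounded_linear bounded_linear_intros)
  from C1_on_compose[OF C1_backward_ray[of UNIV e] this]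
  have "C1_on UNIV (\<lambda>q::('a \<times> real) \<times> real. fst (fst q) - (snd (fst q) * snd q) *\<^sub>R e)"
    by simp
  then have b: "C1_on UNIV b"
    unfolding b_def by (rule C1_on_compose[OF a]) simp
  let ?b' = "\<lambda>q v. a' (fst (fst q) - (snd (fst q) * snd q) *\<^sub>R e)
       (fst (fst v) - (snd (fst v) * snd q + snd (fst q) * snd v) *\<^sub>R e)"
  have b': "(b has_derivative ?b' q) (at q)" for q
    unfolding b_def
    by (rule has_derivative_compose[OF _ a']) (auto intro!: derivative_eq_intros)
  have A_eq: "absorption e a = (\<lambda>p. snd p *\<^sub>R integral {0..1} (\<lambda>\<theta>. b (p, \<theta>)))"
    by (simp add: absorption_def b_def fun_eq_iff)
  show "C1_on UNIV (absorption e a)"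
    unfolding A_eq
    by (intro C1_on_scaleR C1_on_bounded_linear bounded_linear_snd
        C1_on_integral_parameter[OF b b'])
  define I where "I = integral {0..1} (\<lambda>\<theta>. a (z - (s * \<theta>) *\<^sub>R e))"
  define J where "J = integral {0..1} (\<lambda>\<theta>. a' (z - (s * \<theta>) *\<^sub>R e) ((1 - \<theta>) *\<^sub>R e))"
  have D: "(absorption e a has_derivative
      (\<lambda>v. s *\<^sub>R integral {0..1} (\<lambda>\<theta>. ?b' ((z, s), \<theta>) (v, 0)) + snd v *\<^sub>R I)) (at (z, s))"
    unfolding A_eq
    using has_derivative_scaleR[OF has_derivative_snd[OF has_derivative_ident]
        has_derivative_integral_parameter[OF b b', of 0 1]]
    by (rule has_derivative_eq_rhs) (simp add: b_def I_def)
  \<comment> \<open>The integrand is the derivative of \<open>-(1 - \<theta>) a(z - s\<theta>e)\<close>: the factor \<open>1 - \<theta>\<close> kills the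
    value at the far end and leaves \<open>a z\<close> from the near one.\<close>
  have "((\<lambda>\<theta>. s *\<^sub>R a' (z - (s * \<theta>) *\<^sub>R e) ((1 - \<theta>) *\<^sub>R e) + a (z - (s * \<theta>) *\<^sub>R e))
     has_integral (- ((1 - 1) *\<^sub>R a (z - (s * 1) *\<^sub>R e)) - (- ((1 - 0) *\<^sub>R a (z - (s * 0) *\<^sub>R e))))) {0..1}"
  proof (rule fundamental_theorem_of_calculus)
    fix \<theta> :: real assume "\<theta> \<in> {0..1}"
    have D1: "((\<lambda>\<theta>. a (z - (s * \<theta>) *\<^sub>R e)) has_derivative
        (\<lambda>h. a' (z - (s * \<theta>) *\<^sub>R e) (- ((s * h) *\<^sub>R e)))) (at \<theta> within {0..1})"
      by (rule has_derivative_compose[OF _ a']) (auto intro!: derivative_eq_intros)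
    show "((\<lambda>\<theta>. - ((1 - \<theta>) *\<^sub>R a (z - (s * \<theta>) *\<^sub>R e))) has_vector_derivative
       s *\<^sub>R a' (z - (s * \<theta>) *\<^sub>R e) ((1 - \<theta>) *\<^sub>R e) + a (z - (s * \<theta>) *\<^sub>R e)) (at \<theta> within {0..1})"
      unfolding has_vector_derivative_def
      by (rule has_derivative_eq_rhs[OF has_derivative_minus[OF has_derivative_scaleR[OF
            has_derivative_diff[OF has_derivative_const has_derivative_ident] D1]]])
        (simp add: blinfun.bilinear_simps algebra_simps)
  qed simp
  then have "((\<lambda>\<theta>. s *\<^sub>R a' (z - (s * \<theta>) *\<^sub>R e) ((1 - \<theta>) *\<^sub>R e) + a (z - (s * \<theta>) *\<^sub>R e))
     has_integral a z) {0..1}"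
    by simp
  moreover have "((\<lambda>\<theta>. s *\<^sub>R a' (z - (s * \<theta>) *\<^sub>R e) ((1 - \<theta>) *\<^sub>R e) + a (z - (s * \<theta>) *\<^sub>R e))
     has_integral (s *\<^sub>R J + I)) {0..1}"
    unfolding I_def J_def
    by (intro has_integral_add has_integral_cmul integrable_integral integrable_continuous_real
        continuous_intros continuous_on_compose2[OF ca] continuous_on_compose2[OF ca']) auto
  ultimately have J: "s *\<^sub>R J + I = a z"
    by (rule has_integral_unique[symmetric])
  show "A' (e, 1) = a z" if "(absorption e a has_derivative A') (at (z, s))"
    using has_derivative_unique[OF that D] J by (simp add: J_def scaleR_diff_left)
qed

section \<open>The transport equation for the ray transform\<close>

definition ray_integrand ::
  "'a::euclidean_space \<Rightarrow> ('a \<Rightarrow> complex) \<Rightarrow> ('a \<Rightarrow> complex) \<Rightarrow> nat \<Rightarrow> 'a \<times> real \<Rightarrow> complex" where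
  "ray_integrand e a F k p =
     of_real (snd p) ^ k * (exp (- absorption e a p) * F (fst p - snd p *\<^sub>R e))"

lemma C1_ray_integrand:
  assumes "C1_on UNIV a" and "C1_on UNIV F"
  shows "C1_on UNIV (ray_integrand e a F k)"
proof -
  have "C1_on UNIV (\<lambda>p::'a \<times> real. of_real (snd p) ^ k :: complex)"
  proof (induction k)
    case (Suc k)
    show ?case
      unfolding power_Suc
      by (intro C1_on_mult C1_on_bounded_linear Suc
          bounded_linear_compose[OF bounded_linear_of_real bounded_linear_snd])
  qed (simp add: C1_on_const)
  moreover have "C1_on UNIV (\<lambda>p. exp (- absorption e a p))"
    using C1_on_mult[OF C1_on_const[of _ "-1"] C1_absorption[OF assms(1), of e]]
    by (intro C1_on_compose[OF C1_on_exp[of UNIV]]) simp_all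
  moreover have "C1_on UNIV (\<lambda>p. F (fst p - snd p *\<^sub>R e))"
    by (rule C1_on_compose[OF assms(2) C1_backward_ray]) simp
  ultimately show ?thesis
    unfolding ray_integrand_def by (intro C1_on_mult)
qed

text \<open>Along \<open>(e, 1)\<close> the factor \<open>F(z - se)\<close> is constant, so only the weight \<open>s\<^sup>k\<close> and the
  exponential contribute. For \<open>k = 0\<close> the coefficient \<open>of_nat k\<close> makes the truncated index \<open>k - 1\<close>
  harmless.\<close>

lemma ray_integrand_flow_derivative:
  assumes a: "C1_on UNIV a" and F: "C1_on UNIV F"
    and h': "(ray_integrand e a F k has_derivative h') (at (z, s))"
  shows "h' (e, 1) =
    of_nat k * ray_integrand e a F (k - 1) (z, s) - a z * ray_integrand e a F k (z, s)"
proof -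
  obtain A' where A': "(absorption e a has_derivative A') (at (z, s))"
    using C1_onE[OF C1_absorption[OF a, of e]] by (metis UNIV_I)
  obtain F' where F': "\<And>x. (F has_derivative blinfun_apply (F' x)) (at x)"
    using C1_onE[OF F] by (metis UNIV_I)
  have Fray: "((\<lambda>p. F (fst p - snd p *\<^sub>R e)) has_derivative
      (\<lambda>v. F' (z - s *\<^sub>R e) (fst v - snd v *\<^sub>R e))) (at (z, s))"
    by (rule has_derivative_compose[of "\<lambda>p. fst p - snd p *\<^sub>R e" _ "(z, s)" UNIV F, simplified])
      (auto intro!: derivative_eq_intros F')
  have pow: "((\<lambda>p::'a \<times> real. of_real (snd p) ^ k :: complex) has_derivative
      (\<lambda>v. of_nat k * of_real (snd v) * of_real s ^ (k - 1))) (at (z, s))"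
    by (auto intro!: derivative_eq_intros)
  have "(ray_integrand e a F k has_derivative
      (\<lambda>v. of_real s ^ k * (exp (- absorption e a (z, s)) * F' (z - s *\<^sub>R e) (fst v - snd v *\<^sub>R e)
          + exp (- absorption e a (z, s)) * (- A' v) * F (z - s *\<^sub>R e))
        + of_nat k * of_real (snd v) * of_real s ^ (k - 1)
          * (exp (- absorption e a (z, s)) * F (z - s *\<^sub>R e)))) (at (z, s))"
  proof -
    have "((\<lambda>p. exp (- absorption e a p)) has_derivative
        (\<lambda>v. exp (- absorption e a (z, s)) * (- A' v))) (at (z, s))"
      using has_derivative_compose[OF has_derivative_minus[OF A'],
          of exp "\<lambda>v. exp (- absorption e a (z, s)) * v"]
        DERIV_exp[of "- absorption e a (z, s)"]
      by (simp add: has_field_derivative_def)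
    from has_derivative_mult[OF pow has_derivative_mult[OF this Fray]] show ?thesis
      by (simp add: ray_integrand_def[abs_def])
  qed
  from has_derivative_unique[OF h' this] show ?thesis
    by (simp add: absorption_flow_derivative[OF a A'] ray_integrand_def algebra_simps)
qed

text \<open>Since \<open>(e, 0) = (e, 1) - (0, 1)\<close>, the derivative of the integrand along \<open>e\<close> is given by
  \<open>ray_integrand_flow_derivative\<close> up to a term \<open>-\<partial>\<^sub>s h\<close>, and the integral of that term is a boundary
  value: zero at the far end, where \<open>F\<close> vanishes, and \<open>0\<^sup>k F(z)\<close> at \<open>s = 0\<close>. The hypothesis \<open>vanish\<close>
  makes the range of integration finite uniformly near \<open>z\<close>, as differentiation under the integral
  requires.\<close>

lemma ray_transform_transport_equation:
  fixes U :: "nat \<Rightarrow> 'a::euclidean_space \<Rightarrow> complex"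
  assumes a: "C1_on UNIV a" and F: "C1_on UNIV F"
    and vanish: "0 < r" "0 \<le> R" "\<And>y s. y \<in> ball z r \<Longrightarrow> R \<le> s \<Longrightarrow> F (y - s *\<^sub>R e) = 0"
    and U: "\<And>k y. U k y = integral {0..} (\<lambda>s. ray_integrand e a F k (y, s))"
  obtains U' where "(U k has_derivative U') (at z)"
    and "U' e + a z * U k z = (if k = 0 then F z else of_nat k * U (k - 1) z)"
proof -
  let ?h = "ray_integrand e a F"
  note C1 = C1_ray_integrand[OF a F]
  obtain h' where h': "\<And>p. (?h k has_derivative blinfun_apply (h' p)) (at p)"
    and ch': "continuous_on UNIV h'"
    using C1_onE[OF C1] by (metis UNIV_I)
  have ch: "continuous_on S (\<lambda>s. ?h j (y, s))" for S j y
    by (intro continuous_on_compose2[OF C1_on_continuous_on[OF C1]] continuous_intros) auto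
  have has_int: "((\<lambda>s. ?h j (y, s)) has_integral integral {0..R} (\<lambda>s. ?h j (y, s))) {0..R}" for j y
    by (intro integrable_integral integrable_continuous_real ch)
  have U_eq: "U j y = integral {0..R} (\<lambda>s. ?h j (y, s))" if "y \<in> ball z r" for j y
  proof -
    have "((\<lambda>s. if s \<in> {0..R} then ?h j (y, s) else 0) has_integral
        integral {0..R} (\<lambda>s. ?h j (y, s))) {0..}"
      by (subst has_integral_restrict) (use has_int in simp_all)
    then have "((\<lambda>s. ?h j (y, s)) has_integral integral {0..R} (\<lambda>s. ?h j (y, s))) {0..}"
      by (rule has_integral_eq[rotated]) (use vanish(3)[OF that] in \<open>auto simp: ray_integrand_def\<close>)
    then show ?thesis
      unfolding U by (rule integral_unique)
  qed
  define U' where "U' v = integral {0..R} (\<lambda>s. h' (z, s) (v, 0))" for v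
  have "((\<lambda>y. integral {0..R} (\<lambda>s. ?h k (y, s))) has_derivative U') (at z)"
    unfolding U'_def by (rule has_derivative_integral_parameter[OF C1 h'])
  then have D: "(U k has_derivative U') (at z)"
    by (rule has_derivative_transform_within_open[of _ _ _ _ "ball z r"])
      (use vanish(1) U_eq in auto)
  have "((\<lambda>s. h' (z, s) (0, 1)) has_integral ?h k (z, R) - ?h k (z, 0)) {0..R}"
  proof (rule fundamental_theorem_of_calculus[OF vanish(2)])
    fix s
    have "((\<lambda>s. (z, s)) has_derivative (\<lambda>v. (0, v))) (at s within {0..R})"
      by (auto intro!: derivative_eq_intros)
    from has_derivative_compose[OF this h']
    have "((\<lambda>s. ?h k (z, s)) has_derivative (\<lambda>v. h' (z, s) (v *\<^sub>R (0, 1)))) (at s within {0..R})"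
      by simp
    then show "((\<lambda>s. ?h k (z, s)) has_vector_derivative h' (z, s) (0, 1)) (at s within {0..R})"
      by (simp only: has_vector_derivative_def blinfun.scaleR_right)
  qed
  moreover have "?h k (z, R) = 0"
    using vanish(1) vanish(3)[of z R] by (simp add: ray_integrand_def)
  moreover have "?h k (z, 0) = (if k = 0 then F z else 0)"
    by (simp add: ray_integrand_def absorption_def power_0_left)
  ultimately have bdry: "((\<lambda>s. h' (z, s) (0, 1)) has_integral - (if k = 0 then F z else 0)) {0..R}"
    by simp
  have z: "z \<in> ball z r"
    using vanish(1) by simp
  have "((\<lambda>s. of_nat k * ?h (k - 1) (z, s) - a z * ?h k (z, s) - h' (z, s) (0, 1)) has_integral
      of_nat k * U (k - 1) z - a z * U k z - - (if k = 0 then F z else 0)) {0..R}"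
    unfolding U_eq[OF z]
    by (intro has_integral_diff has_integral_mult_right has_int bdry)
  moreover have "of_nat k * ?h (k - 1) (z, s) - a z * ?h k (z, s) - h' (z, s) (0, 1)
      = h' (z, s) (e, 0)" for s
    using ray_integrand_flow_derivative[OF a F h', of z s]
      blinfun.diff_right[of "h' (z, s)" "(e, 1)" "(0, 1)"] by simp
  ultimately have "U' e = of_nat k * U (k - 1) z - a z * U k z - - (if k = 0 then F z else 0)"
    unfolding U'_def by (simp add: integral_unique)
  then show ?thesis
    by (intro that[OF D]) simp
qed

section \<open>The attenuated ray transform in space-time\<close>

lemma ART_eq_integral_ray_integrand:
  "ART k \<alpha> f t x \<xi> = integral {0..}
     (\<lambda>s. ray_integrand (1, \<xi>) (\<lambda>z. \<alpha> (snd z) \<xi>) (\<lambda>z. f (fst z) (snd z) \<xi>) k ((t, x), s))"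
  unfolding ART_def
  by (rule integral_cong) (simp add: ray_integrand_def absorption_eq_integral)

text \<open>For \<open>norm \<xi> = 1\<close> the rays leave a bounded set after a time that is uniform for starting points in
  a ball, whatever the time coordinate. The time and space derivatives of the transform are the two
  parts of its joint derivative, so their sum in \<open>transport_op\<close> is the derivative along
  \<open>(1, \<xi>)\<close>.\<close>

lemma
  assumes a: "C1_on UNIV (\<lambda>z::real \<times> (real^3). \<alpha> (snd z) \<xi>)"
    and F: "C1_on UNIV (\<lambda>z. f (fst z) (snd z) \<xi>)"
    and K: "bounded K" "\<And>t x. x \<notin> K \<Longrightarrow> f t x \<xi> = 0"
    and \<xi>: "norm \<xi> = 1"
  shows ART_differentiable_time: "(\<lambda>t'. ART k \<alpha> f t' x \<xi>) differentiable (at t)"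
    and ART_differentiable_space: "(\<lambda>y. ART k \<alpha> f t y \<xi>) differentiable (at x)"
    and transport_op_ART: "transport_op \<alpha> (ART k \<alpha> f) t x \<xi> =
      (if k = 0 then f t x \<xi> else of_nat k * ART (k - 1) \<alpha> f t x \<xi>)"
proof -
  define U where "U j z = ART j \<alpha> f (fst z) (snd z) \<xi>" for j z
  obtain M where M: "\<And>x. x \<in> K \<Longrightarrow> norm x \<le> M"
    using K(1) unfolding bounded_iff by blast
  \<comment> \<open>A ray that starts within distance 1 of \<open>x\<close> is farther than \<open>M\<close> from the origin at every time
    \<open>s \<ge> M + norm x + 1\<close>; the absolute value makes \<open>R\<close> positive.\<close>
  define R where "R = \<bar>M\<bar> + norm x + 1"
  have vanish: "f (fst (y - s *\<^sub>R (1, \<xi>))) (snd (y - s *\<^sub>R (1, \<xi>))) \<xi> = 0"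
    if "y \<in> ball (t, x) 1" and "R \<le> s" for y s
  proof -
    have "0 \<le> s"
      using that(2) norm_ge_zero[of x] unfolding R_def by linarith
    have "dist x (snd y) < 1"
      using that(1) dist_snd_le[of "(t, x)" y] by simp
    then have "norm (snd y) < norm x + 1"
      using norm_triangle_ineq2[of "snd y" x] by (simp add: dist_norm norm_minus_commute)
    then have "M < norm (s *\<^sub>R \<xi>) - norm (snd y)"
      using that(2) \<xi> \<open>0 \<le> s\<close> by (simp add: R_def)
    also have "\<dots> \<le> norm (snd y - s *\<^sub>R \<xi>)"
      by (metis norm_minus_commute norm_triangle_ineq2)
    finally have "snd y - s *\<^sub>R \<xi> \<notin> K"
      using M by (meson not_le)
    then show ?thesis
      by (simp add: K(2))
  qed
  obtain U' where U': "(U k has_derivative U') (at (t, x))"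
    and eq: "U' (1, \<xi>) + \<alpha> (snd (t, x)) \<xi> * U k (t, x)
        = (if k = 0 then f (fst (t, x)) (snd (t, x)) \<xi> else of_nat k * U (k - 1) (t, x))"
  proof (rule ray_transform_transport_equation[where U = U and k = k and R = R and z = "(t, x)",
        OF a F zero_less_one])
    show "0 \<le> R"
      by (simp add: R_def add_nonneg_nonneg)
    show "U j y = integral {0..} (\<lambda>s. ray_integrand (1, \<xi>) (\<lambda>z. \<alpha> (snd z) \<xi>)
        (\<lambda>z. f (fst z) (snd z) \<xi>) j (y, s))" for j y
      by (simp add: U_def ART_eq_integral_ray_integrand)
    show "f (fst (y - s *\<^sub>R (1, \<xi>))) (snd (y - s *\<^sub>R (1, \<xi>))) \<xi> = 0"
      if "y \<in> ball (t, x) 1" and "R \<le> s" for y s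
      using that by (rule vanish)
  qed (rule that)
  interpret U': bounded_linear U'
    using U' by (rule has_derivative_bounded_linear)
  have "((\<lambda>t'. (t', x)) has_derivative (\<lambda>h. (h, 0))) (at t)"
    by (auto intro!: derivative_eq_intros)
  from has_derivative_compose[OF this U']
  have dt: "((\<lambda>t'. ART k \<alpha> f t' x \<xi>) has_derivative (\<lambda>h. U' (h, 0))) (at t)"
    by (simp add: U_def)
  have "((\<lambda>y. (t, y)) has_derivative (\<lambda>v. (0, v))) (at x)"
    by (auto intro!: derivative_eq_intros)
  from has_derivative_compose[OF this U']
  have dx: "((\<lambda>y. ART k \<alpha> f t y \<xi>) has_derivative (\<lambda>v. U' (0, v))) (at x)"
    by (simp add: U_def)
  show "(\<lambda>t'. ART k \<alpha> f t' x \<xi>) differentiable (at t)"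
    and "(\<lambda>y. ART k \<alpha> f t y \<xi>) differentiable (at x)"
    using dt dx by (auto intro: differentiableI)
  have "((\<lambda>\<tau>. x + \<tau> *\<^sub>R \<xi>) has_derivative (\<lambda>h. h *\<^sub>R \<xi>)) (at 0)"
    by (auto intro!: derivative_eq_intros)
  from has_derivative_compose[OF this, of "\<lambda>y. ART k \<alpha> f t y \<xi>" "\<lambda>v. U' (0, v)"] dx
  have "((\<lambda>\<tau>. ART k \<alpha> f t (x + \<tau> *\<^sub>R \<xi>) \<xi>) has_derivative (\<lambda>h. U' (h *\<^sub>R (0, \<xi>)))) (at 0)"
    by simp
  then have "H_op (ART k \<alpha> f) t x \<xi> = U' (0, \<xi>)"
    unfolding H_op_def
    by (intro vector_derivative_at) (simp only: has_vector_derivative_def U'.scaleR)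
  moreover have "vector_derivative (\<lambda>t'. ART k \<alpha> f t' x \<xi>) (at t) = U' (1, 0)"
  proof (rule vector_derivative_at)
    have "(\<lambda>h. U' (h, 0)) = (\<lambda>h. h *\<^sub>R U' (1, 0))"
      by (simp flip: U'.scaleR)
    then show "((\<lambda>t'. ART k \<alpha> f t' x \<xi>) has_vector_derivative U' (1, 0)) (at t)"
      using dt by (simp add: has_vector_derivative_def)
  qed
  moreover have "U' (1, 0) + U' (0, \<xi>) = U' (1, \<xi>)"
    by (simp flip: U'.add)
  ultimately show "transport_op \<alpha> (ART k \<alpha> f) t x \<xi> =
      (if k = 0 then f t x \<xi> else of_nat k * ART (k - 1) \<alpha> f t x \<xi>)"
    using eq by (simp add: transport_op_def U_def)
qed

section \<open>Iterated transport operators\<close>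

text \<open>The two functions have to be proportional in the direction \<open>\<xi>\<close> only, because \<open>transport_op\<close>
  differentiates in \<open>t\<close> and \<open>x\<close>. This is what allows \<open>\<xi>\<close> to stay fixed when the operator is
  iterated.\<close>

lemma transport_op_cmult:
  assumes "\<And>t x. \<psi> t x \<xi> = c * \<phi> t x \<xi>"
    and "(\<lambda>t'. \<phi> t' x \<xi>) differentiable (at t)" and "(\<lambda>y. \<phi> t y \<xi>) differentiable (at x)"
  shows "transport_op \<alpha> \<psi> t x \<xi> = c * transport_op \<alpha> \<phi> t x \<xi>"
proof -
  have cmult: "vector_derivative (\<lambda>s. c * g s) (at s0) = c * vector_derivative g (at s0)"
    if "g differentiable (at s0)" for g :: "real \<Rightarrow> complex" and s0
    using that by (intro vector_derivative_at has_vector_derivative_mult_right)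
      (simp add: vector_derivative_works)
  have "(\<lambda>\<tau>. \<phi> t (x + \<tau> *\<^sub>R \<xi>) \<xi>) differentiable (at 0)"
    by (rule differentiable_compose[of "\<lambda>y. \<phi> t y \<xi>"]) (simp_all add: assms(3))
  with assms(2) show ?thesis
    by (simp add: transport_op_def H_op_def assms(1) cmult algebra_simps)
qed

text \<open>Lowering the order from \<open>k\<close> to \<open>k - j - 1\<close> produces the factor \<open>k (k - 1) \<cdots> (k - j)\<close>, and the
  normalisation of the operators divides it by \<open>j!\<close>; the quotient is \<open>(k choose j) (k - j)\<close>. In the
  last step, \<open>j = k\<close>, the equation of order 0 contributes \<open>f\<close> without a further factor, and
  \<open>k choose k = 1\<close> remains. The formula starts at \<open>L_op \<alpha> (Suc 0)\<close> because the
  identity \<open>L_op \<alpha> 0\<close> does not fit the pattern.\<close>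

lemma
  fixes u :: "nat \<Rightarrow> real \<Rightarrow> real^3 \<Rightarrow> real^3 \<Rightarrow> complex"
  assumes dt: "\<And>k t x. (\<lambda>t'. u k t' x \<xi>) differentiable (at t)"
    and dx: "\<And>k t x. (\<lambda>y. u k t y \<xi>) differentiable (at x)"
    and eq: "\<And>k t x. transport_op \<alpha> (u k) t x \<xi> =
      (if k = 0 then f t x \<xi> else of_nat k * u (k - 1) t x \<xi>)"
  shows L_op_hierarchy: "j \<le> k \<Longrightarrow> L_op \<alpha> (Suc j) (u k) t x \<xi> =
      of_nat (k choose j) * (if j = k then f t x \<xi> else of_nat (k - j) * u (k - j - 1) t x \<xi>)"
    and L_op_hierarchy_differentiable: "j \<le> k \<Longrightarrow>
      (\<lambda>t'. L_op \<alpha> j (u k) t' x \<xi>) differentiable (at t) \<and>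
      (\<lambda>y. L_op \<alpha> j (u k) t y \<xi>) differentiable (at x)"
proof -
  show L: "L_op \<alpha> (Suc j) (u k) t x \<xi> =
      of_nat (k choose j) * (if j = k then f t x \<xi> else of_nat (k - j) * u (k - j - 1) t x \<xi>)"
    if "j \<le> k" for j t x
    using that
  proof (induction j arbitrary: t x)
    case 0
    then show ?case by (simp add: eq)
  next
    case (Suc j)
    have "transport_op \<alpha> (L_op \<alpha> (Suc j) (u k)) t x \<xi> =
        of_nat ((k choose j) * (k - j)) * transport_op \<alpha> (u (k - j - 1)) t x \<xi>"
      using Suc by (intro transport_op_cmult dt dx) simp
    moreover have "(k choose j) * (k - j) = Suc j * (k choose Suc j)"
      by (metis binomial_absorb_comp binomial_absorption mult.commute diff_Suc_1)
    ultimately have "transport_op \<alpha> (L_op \<alpha> (Suc j) (u k)) t x \<xi> =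
        of_nat (Suc j) * (of_nat (k choose Suc j) * transport_op \<alpha> (u (k - j - 1)) t x \<xi>)"
      by (simp only: of_nat_mult mult.assoc)
    then have "L_op \<alpha> (Suc (Suc j)) (u k) t x \<xi> =
        of_nat (k choose Suc j) * transport_op \<alpha> (u (k - j - 1)) t x \<xi>"
      by (simp del: of_nat_Suc)
    then show ?case
      using Suc.prems unfolding eq by auto
  qed
  show "(\<lambda>t'. L_op \<alpha> j (u k) t' x \<xi>) differentiable (at t) \<and>
      (\<lambda>y. L_op \<alpha> j (u k) t y \<xi>) differentiable (at x)" if "j \<le> k"
  proof (cases j)
    case 0
    then show ?thesis by (simp add: dt dx)
  next
    case (Suc i)
    have L_j: "L_op \<alpha> j (u k) t x \<xi> =
        of_nat (k choose i) * (of_nat (k - i) * u (k - i - 1) t x \<xi>)" for t x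
    proof -
      have "i \<le> k" and "i \<noteq> k"
        using that Suc by simp_all
      then show ?thesis
        unfolding Suc L[OF \<open>i \<le> k\<close>] by (simp only: if_False)
    qed
    show ?thesis
      unfolding L_j by (intro conjI differentiable_mult differentiable_const dt dx)
  qed
qed

lemma ART_classical_solution:
  assumes "\<And>\<xi>. \<xi> \<in> S2 \<Longrightarrow> C1_on UNIV (\<lambda>z::real \<times> (real^3). \<alpha> (snd z) \<xi>)"
    and "\<And>\<xi>. \<xi> \<in> S2 \<Longrightarrow> C1_on UNIV (\<lambda>z. f (fst z) (snd z) \<xi>)"
    and "bounded K" and "\<And>t x \<xi>. \<xi> \<in> S2 \<Longrightarrow> x \<notin> K \<Longrightarrow> f t x \<xi> = 0"
  shows "classical_solution D \<alpha> (k + 1) (ART k \<alpha> f) f"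
  unfolding classical_solution_def
proof (intro allI ballI)
  fix t x \<xi> assume "\<xi> \<in> S2"
  then have n: "norm \<xi> = 1"
    by simp
  note h = assms(1)[OF \<open>\<xi> \<in> S2\<close>] assms(2)[OF \<open>\<xi> \<in> S2\<close>] assms(3) assms(4)[OF \<open>\<xi> \<in> S2\<close>]
  have dt: "(\<lambda>t'. ART k \<alpha> f t' x \<xi>) differentiable (at t)" for k t x
    by (rule ART_differentiable_time[of \<alpha> \<xi> f K, OF h n])
  have dx: "(\<lambda>y. ART k \<alpha> f t y \<xi>) differentiable (at x)" for k t x
    by (rule ART_differentiable_space[of \<alpha> \<xi> f K, OF h n])
  have eq: "transport_op \<alpha> (ART k \<alpha> f) t x \<xi> =
      (if k = 0 then f t x \<xi> else of_nat k * ART (k - 1) \<alpha> f t x \<xi>)" for k t x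
    by (rule transport_op_ART[of \<alpha> \<xi> f K, OF h n])
  show "(\<forall>j<k + 1. (\<lambda>t'. L_op \<alpha> j (ART k \<alpha> f) t' x \<xi>) differentiable (at t) \<and>
      (\<lambda>y. L_op \<alpha> j (ART k \<alpha> f) t y \<xi>) differentiable (at x)) \<and>
      L_op \<alpha> (k + 1) (ART k \<alpha> f) t x \<xi> = f t x \<xi>"
  proof (intro conjI allI impI)
    show "(\<lambda>t'. L_op \<alpha> j (ART k \<alpha> f) t' x \<xi>) differentiable (at t)"
      and "(\<lambda>y. L_op \<alpha> j (ART k \<alpha> f) t y \<xi>) differentiable (at x)" if "j < k + 1" for j
      using L_op_hierarchy_differentiable[where u = "\<lambda>k. ART k \<alpha> f" and f = f and \<alpha> = \<alpha>
          and \<xi> = \<xi> and k = k and j = j, OF dt dx eq] that by auto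
    show "L_op \<alpha> (k + 1) (ART k \<alpha> f) t x \<xi> = f t x \<xi>"
      using L_op_hierarchy[where u = "\<lambda>k. ART k \<alpha> f" and f = f and \<alpha> = \<alpha> and \<xi> = \<xi>
          and j = k and k = k, OF dt dx eq order_refl] unfolding Suc_eq_plus1 by simp
  qed
qed

text \<open>Where the coefficient is not known to be smooth, off \<open>D\<close> and across its boundary, it is zero
  near each point, since its support in \<open>x\<close> is a compact subset of the open set \<open>D\<close>.\<close>

lemma C1_on_fixed_direction:
  fixes g :: "real^3 \<Rightarrow> real^3 \<Rightarrow> real"
  assumes D: "open D" and \<xi>: "\<xi> \<in> S2"
    and Ck: "Ck_on_submanifold (k + 1) (D \<times> S2) (\<lambda>(x, \<xi>). g x \<xi>)"
    and fin: "bounded_finite S2 D (\<lambda>\<xi> x. g x \<xi>)"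
  shows "C1_on UNIV (\<lambda>x. complex_of_real (g x \<xi>))"
proof -
  obtain K where K: "compact K" "K \<subseteq> D" "\<And>x. x \<notin> K \<Longrightarrow> g x \<xi> = 0"
    using fin \<xi> unfolding bounded_finite_def by blast
  have "C1_on D (\<lambda>x. (x, \<xi>))"
    by (intro C1_on_Pair C1_on_const C1_on_bounded_linear bounded_linear_ident)
  moreover have "(\<lambda>x. (x, \<xi>)) ` D \<subseteq> D \<times> S2"
    using \<xi> by auto
  ultimately have "C1_on D (\<lambda>x. g x \<xi>)"
    using C1_on_pullback_submanifold[OF Ck[unfolded Suc_eq_plus1[symmetric]] _ D] by fastforce
  then have "C1_on UNIV (\<lambda>x. g x \<xi>)"
    using D compact_imp_closed[OF K(1)] K(2,3) by (rule C1_on_extend_by_zero)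
  then show ?thesis
    by (rule C1_on_compose[OF C1_on_bounded_linear[OF bounded_linear_of_real, of UNIV]]) simp
qed

theorem theorem2p6:
  fixes D :: "(real^3) set"
    and k :: nat
    and \<epsilon> \<rho> :: "real^3 \<Rightarrow> real^3 \<Rightarrow> real"
    and \<alpha> :: "real^3 \<Rightarrow> real^3 \<Rightarrow> complex"
    and f :: "real \<Rightarrow> real^3 \<Rightarrow> real^3 \<Rightarrow> complex"
  assumes D: "smooth_bounded_convex_domain D"
    and eps_nonneg: "\<forall>x\<in>D. \<forall>\<xi>\<in>S2. 0 \<le> \<epsilon> x \<xi>"
    and eps_Ck: "Ck_on_submanifold (k + 1) (D \<times> S2) (\<lambda>(x, \<xi>). \<epsilon> x \<xi>)"
    and eps_finite: "bounded_finite S2 D (\<lambda>\<xi> x. \<epsilon> x \<xi>)"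
    and rho_Ck: "Ck_on_submanifold (k + 1) (D \<times> S2) (\<lambda>(x, \<xi>). \<rho> x \<xi>)"
    and rho_finite: "bounded_finite S2 D (\<lambda>\<xi> x. \<rho> x \<xi>)"
    and f_Ck: "Ck_on_submanifold (k + 1) (UNIV \<times> D \<times> S2) (\<lambda>(t, x, \<xi>). f t x \<xi>)"
    and f_finite: "bounded_finite (UNIV \<times> S2) D (\<lambda>(t, \<xi>) x. f t x \<xi>)"
    and alpha: "\<alpha> = (\<lambda>x \<xi>. complex_of_real (\<epsilon> x \<xi>) + \<i> * complex_of_real (\<rho> x \<xi>))"
  shows "classical_solution D \<alpha> (k + 1) (ART k \<alpha> f) f \<and>
    (\<forall>m w. symmetric_tensor_field m w \<longrightarrow>
       bounded_finite (UNIV \<times> {I. length I = m}) D (\<lambda>(t, I) x. w t x I) \<longrightarrow>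
       (\<forall>t. \<forall>x\<in>D. \<forall>\<xi>\<in>S2. f t x \<xi> = tensor_power_pairing m w t x \<xi>) \<longrightarrow>
       classical_solution D \<alpha> (k + 1) (ART k \<alpha> f) (tensor_power_pairing m w))"
proof -
  have "open D"
    using D by (simp add: smooth_bounded_convex_domain_def)
  obtain K where K: "compact K" "K \<subseteq> D"
    and f_zero: "\<And>t x \<xi>. \<xi> \<in> S2 \<Longrightarrow> x \<notin> K \<Longrightarrow> f t x \<xi> = 0"
    using f_finite unfolding bounded_finite_def by auto
  have sol: "classical_solution D \<alpha> (k + 1) (ART k \<alpha> f) f"
  proof (rule ART_classical_solution[OF _ _ compact_imp_bounded[OF K(1)] f_zero])
    fix \<xi> :: "real^3" assume \<xi>: "\<xi> \<in> S2"
    have "C1_on UNIV (\<lambda>x. \<alpha> x \<xi>)"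
      unfolding alpha
      by (intro C1_on_add C1_on_mult C1_on_const C1_on_fixed_direction[OF \<open>open D\<close> \<xi> eps_Ck eps_finite]
          C1_on_fixed_direction[OF \<open>open D\<close> \<xi> rho_Ck rho_finite])
    then show "C1_on UNIV (\<lambda>z::real \<times> (real^3). \<alpha> (snd z) \<xi>)"
      by (rule C1_on_compose[OF _ C1_on_bounded_linear[OF bounded_linear_snd]]) simp
    have "C1_on (UNIV \<times> D) (\<lambda>z::real \<times> (real^3). (fst z, snd z, \<xi>))"
      by (intro C1_on_Pair C1_on_const C1_on_bounded_linear bounded_linear_fst bounded_linear_snd)
    moreover have "(\<lambda>z::real \<times> (real^3). (fst z, snd z, \<xi>)) ` (UNIV \<times> D) \<subseteq> UNIV \<times> D \<times> S2"
      using \<xi> by auto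
    ultimately have "C1_on (UNIV \<times> D) (\<lambda>z. f (fst z) (snd z) \<xi>)"
      using C1_on_pullback_submanifold[OF f_Ck[unfolded Suc_eq_plus1[symmetric]] _
          open_Times[OF open_UNIV \<open>open D\<close>]] by fastforce
    then show "C1_on UNIV (\<lambda>z. f (fst z) (snd z) \<xi>)"
      using open_Times[OF open_UNIV \<open>open D\<close>] closed_Times[OF closed_UNIV compact_imp_closed[OF K(1)]]
      by (rule C1_on_extend_by_zero) (auto simp: mem_Times_iff intro: f_zero[OF \<xi>] subsetD[OF K(2)])
  qed
  \<comment> \<open>A solution with right-hand side \<open>f\<close> also has any right-hand side that agrees with \<open>f\<close> on
    \<open>\<real> \<times> D \<times> S\<^sup>2\<close>, where the equation is posed.\<close>
  moreover have "classical_solution D \<alpha> (k + 1) (ART k \<alpha> f) g"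
    if "\<forall>t. \<forall>x\<in>D. \<forall>\<xi>\<in>S2. f t x \<xi> = g t x \<xi>" for g
    using sol that unfolding classical_solution_def by simp
  ultimately show ?thesis
    by blast
qed

end
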